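(* Let $N \geq 14$ be an even integer and suppose that $N$ is a sum of two primes (i.e. the Goldbach Conjecture holds for $N$). Then $N$ admits a representation as a sum of two primes of one of the following forms: (1) If $N$ has remainder $2$ when divided by $6$, put $x = (N+4)/6$. Then either $N = 3 + (N-3)$ with $N-3$ a prime in Column D, or $N = (6n+1) + (N-6n-1)$ with $6n+1$ and $N-6n-1$ both primes in Column F, for some integer $n$ with $1 \leq n \leq (x-2)/2$ if $x$ is even and $1 \leq n \leq (x-1)/2$ if $x$ is odd. (2) If $N$ has remainder $4$ when divided by $6$, put $x = (N+2)/6$. Then either $N = 3 + (N-3)$ with $N-3$ a prime in Column F, or $N = (6n-1) + (N-6n+1)$ with $6n-1$ and $N-6n+1$ both primes in Column D, for some integer $n$ with $1 \leq n \leq (x-1)/2$ if $x$ is odd and $1 \leq n \leq x/2$ if $x$ is even. (3) If $N$ has remainder $0$ when divided by $6$, put $x = N/6$. Then, for some integer $n$ with $1 \leq n \leq x-1$, either $N = (6n-1) + (N-6n+1)$ with $6n-1$ a prime in Column D and $N-6n+1$ a prime in Column F, or $N = (6n+1) + (N-6n-1)$ with $6n+1$ a prime in Column F and $N-6n-1$ a prime in Column D.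
   Context: The integers $\geq 2$ are arranged in a table with six columns A, B, C, D, E, F, whose row $x$ ($x = 1, 2, 3, \dots$) consists, with $y = x-1$, of the integers $2+6y,\ 3+6y,\ 4+6y,\ 5+6y,\ 6+6y,\ 7+6y$ in Columns A, B, C, D, E, F respectively. In particular, Column D is the set $\{5+6y : y \geq 0 \text{ an integer}\}$ and Column F is the set $\{7+6y : y \geq 0 \text{ an integer}\}$. *)

theory Defs
  imports "HOL-Computational_Algebra.Primes"
begin

text \<open>
  The integers from 2 on are arranged in a six-column table whose row \<open>y + 1\<close>
  (\<open>y \<ge> 0\<close>) is \<open>2 + 6y, 3 + 6y, \<dots>, 7 + 6y\<close>.  The fourth column is D, the sixth is F;
  since F starts at 7, it does not contain 1.
\<close>

definition columnD :: "int set" where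
  "columnD = {5 + 6 * y | y. y \<ge> 0}"

definition columnF :: "int set" where
  "columnF = {7 + 6 * y | y. y \<ge> 0}"

definition goldbach_rep :: "int \<Rightarrow> int \<Rightarrow> int \<Rightarrow> bool" where
  "goldbach_rep N p q \<longleftrightarrow> prime p \<and> prime q \<and> N = p + q"

end

theory Submission
  imports Defs
begin

text \<open>
  A prime other than 2 and 3 is congruent to \<open>\<plusminus>1\<close> modulo 6, so the residue of \<open>N\<close>
  modulo 6 determines which residues the two summands can have; 2 cannot occur since
  \<open>N - 2\<close> is even.  Listing the smaller summand first gives the upper bound on \<open>n\<close>.
\<close>

lemma prime_int_cases:
  fixes p :: int
  assumes "prime p"
  obtains "p = 2" | "p = 3"
    | n where "n \<ge> 1" "p = 6 * n - 1"
    | n where "n \<ge> 1" "p = 6 * n + 1"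
proof -
  have p: "p > 1"
    using assms by (rule prime_gt_1_int)
  have not_dvd: "\<not> d dvd p" if "prime d" "p \<noteq> d" for d :: int
    using that assms primes_dvd_imp_eq by blast
  consider "p = 2" | "p = 3" | "\<not> 2 dvd p" "\<not> 3 dvd p"
    using not_dvd[of 2] not_dvd[of 3] by auto
  then show thesis
  proof cases
    case 3
    \<comment> \<open>Only 1 and 5 are units modulo 6.\<close>
    then have "p mod 6 = 5 \<or> p mod 6 = 1"
      by presburger
    then show thesis
    proof
      assume "p mod 6 = 5"
      with p have "(p + 1) div 6 \<ge> 1" "p = 6 * ((p + 1) div 6) - 1"
        by presburger+
      then show thesis by (rule that(3))
    next
      assume "p mod 6 = 1"
      \<comment> \<open>The residue class of 1 contains 1 itself; \<open>p > 1\<close> excludes it,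
        so the quotient is positive.\<close>
      with p have "p div 6 \<ge> 1" "p = 6 * (p div 6) + 1"
        by presburger+
      then show thesis by (rule that(4))
    qed
  qed (use that in blast)+
qed

text \<open>Membership becomes a bound and a residue, so that \<open>presburger\<close> can settle
  it later without a witness for the row.\<close>

lemma columnD_iff: "k \<in> columnD \<longleftrightarrow> k \<ge> 5 \<and> k mod 6 = 5"
proof
  assume "k \<ge> 5 \<and> k mod 6 = 5"
  then have "k = 5 + 6 * (k div 6) \<and> k div 6 \<ge> 0" by presburger
  then show "k \<in> columnD" unfolding columnD_def by blast
next
  assume "k \<in> columnD"
  then show "k \<ge> 5 \<and> k mod 6 = 5" unfolding columnD_def by auto
qed

lemma columnF_iff: "k \<in> columnF \<longleftrightarrow> k \<ge> 7 \<and> k mod 6 = 1"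
proof
  assume "k \<ge> 7 \<and> k mod 6 = 1"
  \<comment> \<open>The shift by one reflects that the column starts at 7 = 6 + 1, so the row index
    is one less than the quotient.\<close>
  then have "k = 7 + 6 * (k div 6 - 1) \<and> k div 6 - 1 \<ge> 0" by presburger
  then show "k \<in> columnF" unfolding columnF_def by blast
next
  assume "k \<in> columnF"
  then show "k \<ge> 7 \<and> k mod 6 = 1" unfolding columnF_def by auto
qed

lemma goldbach_rep_commute: "goldbach_rep N p q \<longleftrightarrow> goldbach_rep N q p"
  unfolding goldbach_rep_def by auto

text \<open>Addition is symmetric, so the summands may be swapped. With \<open>p \<le> q\<close>,
  the index of \<open>p\<close> is at most that of \<open>q\<close> when both lie in the same
  column.\<close>

lemma goldbach_rep_ordered:
  assumes "\<exists>p q. goldbach_rep N p q"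
  obtains p q where "goldbach_rep N p q" "p \<le> q"
proof -
  from assms obtain p q where pq: "goldbach_rep N p q" by blast
  show thesis
  proof (cases "p \<le> q")
    case False
    with pq show thesis
      by (intro that[of q p]) (auto simp: goldbach_rep_commute)
  qed (use pq that in blast)
qed

theorem theorem2:
  fixes N :: int
  assumes "N \<ge> 14" and "even N"
    and "\<exists>p q. goldbach_rep N p q"
  shows
    "(N mod 6 = 2 \<longrightarrow>
       (let x = (N + 4) div 6 in
          (goldbach_rep N 3 (N - 3) \<and> N - 3 \<in> columnD) \<or>
          (\<exists>n. 1 \<le> n \<and> (if even x then n \<le> (x - 2) div 2 else n \<le> (x - 1) div 2) \<and>
               goldbach_rep N (6 * n + 1) (N - 6 * n - 1) \<and>
               6 * n + 1 \<in> columnF \<and> N - 6 * n - 1 \<in> columnF))) \<and>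
     (N mod 6 = 4 \<longrightarrow>
       (let x = (N + 2) div 6 in
          (goldbach_rep N 3 (N - 3) \<and> N - 3 \<in> columnF) \<or>
          (\<exists>n. 1 \<le> n \<and> (if odd x then n \<le> (x - 1) div 2 else n \<le> x div 2) \<and>
               goldbach_rep N (6 * n - 1) (N - 6 * n + 1) \<and>
               6 * n - 1 \<in> columnD \<and> N - 6 * n + 1 \<in> columnD))) \<and>
     (N mod 6 = 0 \<longrightarrow>
       (let x = N div 6 in
          (\<exists>n. 1 \<le> n \<and> n \<le> x - 1 \<and>
               ((goldbach_rep N (6 * n - 1) (N - 6 * n + 1) \<and>
                 6 * n - 1 \<in> columnD \<and> N - 6 * n + 1 \<in> columnF) \<or>
                (goldbach_rep N (6 * n + 1) (N - 6 * n - 1) \<and>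
                 6 * n + 1 \<in> columnF \<and> N - 6 * n - 1 \<in> columnD)))))"
proof -
  obtain p q where pq: "goldbach_rep N p q" "p \<le> q"
    using assms(3) by (rule goldbach_rep_ordered)
  then have primes: "prime p" "prime q" and N: "N = p + q"
    by (auto simp: goldbach_rep_def)
  \<comment> \<open>If one summand were 2, the other would be an even number of size at least 12,
    hence not prime.\<close>
  have not_2: "r \<noteq> 2" if "N = r + s" "prime s" for r s :: int
  proof
    assume "r = 2"
    with that assms have "even s" "s > 2" by auto
    with \<open>prime s\<close> show False using prime_odd_int by auto
  qed
  \<comment> \<open>The larger summand is at least half of 14; this rules out \<open>q = 2\<close>
    and \<open>q = 3\<close> in every case below.\<close>
  have q_ge: "q \<ge> 7"
    using assms(1) pq(2) N by simp
  from primes(1) show ?thesis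
  proof (cases rule: prime_int_cases)
    case 1
    with not_2 N primes show ?thesis by blast
  next
    case 2
    have q: "q = N - 3" using N 2 by simp
    \<comment> \<open>With 3 as a summand, residue 0 would make \<open>q = N - 3\<close> a multiple
      of 3, so only residues 2 and 4 remain.\<close>
    have "N mod 6 \<noteq> 0"
    proof
      assume "N mod 6 = 0"
      with q have "3 dvd q" by presburger
      with primes(2) have "q = 3" using primes_dvd_imp_eq[of 3 q] by simp
      with q_ge show False by simp
    qed
    moreover have "goldbach_rep N 3 (N - 3)"
      using pq(1) 2 q by simp
    moreover have "N - 3 \<in> columnD" if "N mod 6 = 2"
      unfolding columnD_iff using that assms(1) by presburger
    moreover have "N - 3 \<in> columnF" if "N mod 6 = 4"
      unfolding columnF_iff using that assms(1) by presburger
    ultimately show ?thesis by (simp add: Let_def)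
  next
    case (3 n)
    from primes(2) show ?thesis
    proof (cases rule: prime_int_cases)
      case 1
      with q_ge show ?thesis by simp
    next
      case 2
      with q_ge show ?thesis by simp
    next
      case (3 m)
      have N': "N = 6 * (n + m) - 2" using N \<open>p = 6 * n - 1\<close> 3 by simp
      then have mod: "N mod 6 = 4" and x: "(N + 2) div 6 = n + m" by presburger+
      have nm: "n \<le> m" using pq(2) \<open>p = 6 * n - 1\<close> 3 by simp
      have q: "N - 6 * n + 1 = q" using N' 3 by simp
      \<comment> \<open>Here \<open>x = n + m\<close>, so \<open>n \<le> m\<close> gives
        \<open>2 * n \<le> x\<close>. Both branches of the conditional are the floor of
        \<open>x / 2\<close>.\<close>
      have "if odd (n + m) then n \<le> (n + m - 1) div 2 else n \<le> (n + m) div 2"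
        using nm by presburger
      moreover have "6 * n - 1 \<in> columnD" "q \<in> columnD"
        unfolding columnD_iff using \<open>n \<ge> 1\<close> 3 by presburger+
      moreover have "goldbach_rep N (6 * n - 1) q"
        using pq(1) \<open>p = 6 * n - 1\<close> by simp
      ultimately have "1 \<le> n \<and> (if odd (n + m) then n \<le> (n + m - 1) div 2 else n \<le> (n + m) div 2) \<and>
          goldbach_rep N (6 * n - 1) (N - 6 * n + 1) \<and>
          6 * n - 1 \<in> columnD \<and> N - 6 * n + 1 \<in> columnD"
        unfolding q using \<open>n \<ge> 1\<close> by blast
      with mod show ?thesis unfolding Let_def x by auto
    next
      case (4 m)
      have N': "N = 6 * (n + m)" using N \<open>p = 6 * n - 1\<close> 4 by simp
      then have mod: "N mod 6 = 0" and x: "N div 6 = n + m" by presburger+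
      have q: "N - 6 * n + 1 = q" using N' 4 by simp
      have "6 * n - 1 \<in> columnD" "q \<in> columnF"
        unfolding columnD_iff columnF_iff using \<open>n \<ge> 1\<close> 4 by presburger+
      moreover have "goldbach_rep N (6 * n - 1) q"
        using pq(1) \<open>p = 6 * n - 1\<close> by simp
      \<comment> \<open>The upper bound \<open>x - 1\<close> is just \<open>m \<ge> 1\<close>, since
        \<open>x = n + m\<close>.\<close>
      ultimately have "1 \<le> n \<and> n \<le> n + m - 1 \<and>
          goldbach_rep N (6 * n - 1) (N - 6 * n + 1) \<and>
          6 * n - 1 \<in> columnD \<and> N - 6 * n + 1 \<in> columnF"
        unfolding q using \<open>n \<ge> 1\<close> \<open>m \<ge> 1\<close> by simp
      with mod show ?thesis unfolding Let_def x by auto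
    qed
  next
    case (4 n)
    from primes(2) show ?thesis
    proof (cases rule: prime_int_cases)
      case 1
      with q_ge show ?thesis by simp
    next
      case 2
      with q_ge show ?thesis by simp
    next
      case (3 m)
      \<comment> \<open>Residue 0 again, now with the smaller prime in Column F: this yields the
        second alternative.\<close>
      have N': "N = 6 * (n + m)" using N \<open>p = 6 * n + 1\<close> 3 by simp
      then have mod: "N mod 6 = 0" and x: "N div 6 = n + m" by presburger+
      have q: "N - 6 * n - 1 = q" using N' 3 by simp
      have "6 * n + 1 \<in> columnF" "q \<in> columnD"
        unfolding columnD_iff columnF_iff using \<open>n \<ge> 1\<close> 3 by presburger+
      moreover have "goldbach_rep N (6 * n + 1) q"
        using pq(1) \<open>p = 6 * n + 1\<close> by simp
      ultimately have "1 \<le> n \<and> n \<le> n + m - 1 \<and>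
          goldbach_rep N (6 * n + 1) (N - 6 * n - 1) \<and>
          6 * n + 1 \<in> columnF \<and> N - 6 * n - 1 \<in> columnD"
        unfolding q using \<open>n \<ge> 1\<close> \<open>m \<ge> 1\<close> by simp
      with mod show ?thesis unfolding Let_def x by auto
    next
      case (4 m)
      have N': "N = 6 * (n + m) + 2" using N \<open>p = 6 * n + 1\<close> 4 by simp
      then have mod: "N mod 6 = 2" and x: "(N + 4) div 6 = n + m + 1" by presburger+
      have nm: "n \<le> m" using pq(2) \<open>p = 6 * n + 1\<close> 4 by simp
      have q: "N - 6 * n - 1 = q" using N' 4 by simp
      \<comment> \<open>Now \<open>x = n + m + 1\<close>, one more than the sum of the indices, so
        \<open>n \<le> m\<close> gives \<open>2 * n \<le> x - 1\<close>. Both branches are the floor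
        of \<open>(x - 1) / 2\<close>.\<close>
      have "if even (n + m + 1) then n \<le> (n + m + 1 - 2) div 2 else n \<le> (n + m + 1 - 1) div 2"
        using nm by presburger
      moreover have "6 * n + 1 \<in> columnF" "q \<in> columnF"
        unfolding columnF_iff using \<open>n \<ge> 1\<close> 4 by presburger+
      moreover have "goldbach_rep N (6 * n + 1) q"
        using pq(1) \<open>p = 6 * n + 1\<close> by simp
      ultimately have "1 \<le> n \<and>
          (if even (n + m + 1) then n \<le> (n + m + 1 - 2) div 2 else n \<le> (n + m + 1 - 1) div 2) \<and>
          goldbach_rep N (6 * n + 1) (N - 6 * n - 1) \<and>
          6 * n + 1 \<in> columnF \<and> N - 6 * n - 1 \<in> columnF"
        unfolding q using \<open>n \<ge> 1\<close> by blast
      with mod show ?thesis unfolding Let_def x by auto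
    qed
  qed
qed

end
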